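(* Let $F(x,\lambda)=(f_\lambda(x),\lambda)$ and $F'(x,\lambda)=(f'_\lambda(x),\lambda)$ be 1-parameter stable unfoldings of holomorphic map-germs $f,f'\colon(\mathbb C^n,0)\to(\mathbb C^p,0)$ respectively. If $f_\lambda$ and $f'_\lambda$ are $\phi$-equivalent with $\phi(x,\lambda)=\lambda$, then for any holomorphic function germ $g\colon(\mathbb C^d,0)\to(\mathbb C,0)$ that is $\mathscr R$-equivalent to a quasi-homogeneous function, $A_{F,g}(f)$ and $A_{F',g}(f')$ are $\mathscr A$-equivalent.
   Context: $\mathscr A$-equivalence of map-germs is equivalence under germs of biholomorphisms in source and target; $\mathscr R$-equivalence uses only the source. A germ $f\colon(\mathbb C^n,0)\to(\mathbb C^p,0)$ is stable if $\theta(f)=df(\theta_n)+\{\eta\circ f:\eta\in\theta_p\}$, where $\theta(f)$ is the module of vector fields along $f$ and $\theta_s$ the module of germs at $0$ of holomorphic vector fields on $\mathbb C^s$. A 1-parameter stable unfolding (OPSU) of $f$ is a stable map-germ $F\colon(\mathbb C^n\times\mathbb C,0)\to(\mathbb C^p\times\mathbb C,0)$ of the form $F(x,\lambda)=(f_\lambda(x),\lambda)$ with $f_0=f$. The augmentation of $f$ by $F$ via $g$ is (the $\mathscr A$-class of) $A_{F,g}(f)(x,z)=(f_{g(z)}(x),z)$, a germ $(\mathbb C^n\times\mathbb C^d,0)\to(\mathbb C^p\times\mathbb C^d,0)$. $\phi$-equivalence (for $\phi(x,\lambda)=\lambda$): $f_\lambda$ and $f'_\lambda$ are $\phi$-equivalent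 if there are germs of biholomorphisms $h$ of $(\mathbb C^n\times\mathbb C,0)$, $k$ of $(\mathbb C^p\times\mathbb C,0)$ and $l$ of $(\mathbb C,0)$ with $F'\circ h=k\circ F$ and $\pi\circ k=l\circ\pi$, where $\pi\colon\mathbb C^p\times\mathbb C\to\mathbb C$ is the projection. $g$ is quasi-homogeneous if there are positive integer weights $w,w_1,\dots,w_d$ with $g(\lambda^{w_1}z_1,\dots,\lambda^{w_d}z_d)=\lambda^wg(z)$ for all $\lambda$. *)

theory Defs
  imports "HOL-Analysis.Analysis"
begin

no_notation fps_nth (infixl \<open>$\<close> 75)

text \<open>
  The spaces $\mathbb{C}$, $\mathbb{C}^n$ and $\mathbb{C}^n\times\mathbb{C}^d$ are the types
  \<open>complex\<close>, \<open>complex ^ 'n\<close> and \<open>(complex ^ 'n) \<times> (complex ^ 'd)\<close>. The library provides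
  only their real structure uniformly, so complex scalar multiplication comes from a type class.
\<close>

class complex_euclidean_space = euclidean_space +
  fixes scaleC :: "complex \<Rightarrow> 'a \<Rightarrow> 'a"  (infixr \<open>*\<^sub>C\<close> 75)
  assumes scaleC_add_right: "c *\<^sub>C (x + y) = c *\<^sub>C x + c *\<^sub>C y"
    and scaleC_add_left: "(b + c) *\<^sub>C x = b *\<^sub>C x + c *\<^sub>C x"
    and scaleC_scaleC: "b *\<^sub>C c *\<^sub>C x = (b * c) *\<^sub>C x"
    and scaleC_of_real: "of_real r *\<^sub>C x = r *\<^sub>R x"
    and norm_scaleC: "norm (c *\<^sub>C x) = norm c * norm x"

instantiation complex :: complex_euclidean_space
begin

definition scaleC_complex_def: "c *\<^sub>C (x::complex) = c * x"

instance
  by standard (simp_all add: scaleC_complex_def algebra_simps norm_mult scaleR_conv_of_real)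

end

instantiation prod :: (complex_euclidean_space, complex_euclidean_space) complex_euclidean_space
begin

definition scaleC_prod_def: "c *\<^sub>C x = (c *\<^sub>C fst x, c *\<^sub>C snd x)"

instance
proof
  fix b c :: complex and x y :: "'a \<times> 'b" and r :: real
  show "c *\<^sub>C (x + y) = c *\<^sub>C x + c *\<^sub>C y" "(b + c) *\<^sub>C x = b *\<^sub>C x + c *\<^sub>C x"
    "b *\<^sub>C c *\<^sub>C x = (b * c) *\<^sub>C x" "of_real r *\<^sub>C x = r *\<^sub>R x"
    by (simp_all add: scaleC_prod_def scaleC_add_right scaleC_add_left scaleC_scaleC
        scaleC_of_real prod_eq_iff)
  show "norm (c *\<^sub>C x) = norm c * norm x"
    by (simp add: scaleC_prod_def norm_prod_def norm_scaleC power_mult_distrib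
        real_sqrt_mult flip: distrib_left)
qed

end

instantiation vec :: (complex_euclidean_space, finite) complex_euclidean_space
begin

definition scaleC_vec_def: "c *\<^sub>C x = (\<chi> i. c *\<^sub>C (x $ i))"

instance
proof
  fix b c :: complex and x y :: "'a ^ 'b" and r :: real
  show "c *\<^sub>C (x + y) = c *\<^sub>C x + c *\<^sub>C y" "(b + c) *\<^sub>C x = b *\<^sub>C x + c *\<^sub>C x"
    "b *\<^sub>C c *\<^sub>C x = (b * c) *\<^sub>C x" "of_real r *\<^sub>C x = r *\<^sub>R x"
    by (simp_all add: scaleC_vec_def scaleC_add_right scaleC_add_left scaleC_scaleC
        scaleC_of_real vec_eq_iff)
  show "norm (c *\<^sub>C x) = norm c * norm x"
    by (simp add: scaleC_vec_def norm_vec_def norm_scaleC L2_set_right_distrib)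
qed

end

text \<open>
  Germs at 0 are represented by total functions; only their values near 0 matter, and two
  representatives give the same germ iff they agree eventually in \<open>nhds 0\<close>.
\<close>

definition holomorphic_germ ::
    "('a::complex_euclidean_space \<Rightarrow> 'b::complex_euclidean_space) \<Rightarrow> bool" where
  "holomorphic_germ f \<longleftrightarrow>
    (\<exists>U. open U \<and> 0 \<in> U \<and>
      (\<forall>x\<in>U. \<exists>f'. (f has_derivative f') (at x) \<and> (\<forall>c v. f' (c *\<^sub>C v) = c *\<^sub>C f' v)))"

lemma holomorphic_germ_complex_iff:
  "holomorphic_germ (f :: complex \<Rightarrow> complex) \<longleftrightarrow> f analytic_on {0}"
proof -
  have "(\<exists>f'. (f has_derivative f') (at x) \<and> (\<forall>c v. f' (c *\<^sub>C v) = c *\<^sub>C f' v)) \<longleftrightarrow>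
      f field_differentiable at x" for x
  proof
    assume "\<exists>f'. (f has_derivative f') (at x) \<and> (\<forall>c v. f' (c *\<^sub>C v) = c *\<^sub>C f' v)"
    then obtain f' where f': "(f has_derivative f') (at x)"
      and lin: "\<And>c v. f' (c * v) = c * f' v"
      by (auto simp: scaleC_complex_def)
    have "f' = (*) (f' 1)"
    proof
      fix v show "f' v = f' 1 * v"
        using lin[of v 1] by (simp add: mult.commute)
    qed
    with f' have "(f has_derivative (*) (f' 1)) (at x)"
      by simp
    then show "f field_differentiable at x"
      unfolding field_differentiable_def has_field_derivative_def by blast
  next
    assume "f field_differentiable at x"
    then obtain D where "(f has_derivative (*) D) (at x)"
      unfolding field_differentiable_def has_field_derivative_def by blast
    then show "\<exists>f'. (f has_derivative f') (at x) \<and> (\<forall>c v. f' (c *\<^sub>C v) = c *\<^sub>C f' v)"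
      by (intro exI[of _ "(*) D"]) (auto simp: scaleC_complex_def)
  qed
  moreover have "f holomorphic_on U \<longleftrightarrow> (\<forall>x\<in>U. f field_differentiable at x)" if "open U" for U
    using that by (metis at_within_open holomorphic_on_def)
  ultimately show ?thesis
    unfolding holomorphic_germ_def analytic_at by (simp cong: conj_cong)
qed

definition map_germ ::
    "('a::complex_euclidean_space \<Rightarrow> 'b::complex_euclidean_space) \<Rightarrow> bool" where
  "map_germ f \<longleftrightarrow> holomorphic_germ f \<and> f 0 = 0"

definition biholomorphism_germ :: "('a::complex_euclidean_space \<Rightarrow> 'a) \<Rightarrow> bool" where
  "biholomorphism_germ h \<longleftrightarrow> map_germ h \<and>
    (\<exists>k. map_germ k \<and> (\<forall>\<^sub>F x in nhds 0. k (h x) = x) \<and> (\<forall>\<^sub>F y in nhds 0. h (k y) = y))"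

definition A_equivalent ::
    "('a::complex_euclidean_space \<Rightarrow> 'b::complex_euclidean_space) \<Rightarrow> ('a \<Rightarrow> 'b) \<Rightarrow> bool" where
  "A_equivalent f f' \<longleftrightarrow>
    (\<exists>h k. biholomorphism_germ h \<and> biholomorphism_germ k \<and>
      (\<forall>\<^sub>F x in nhds 0. f' (h x) = k (f x)))"

definition R_equivalent ::
    "('a::complex_euclidean_space \<Rightarrow> 'b::complex_euclidean_space) \<Rightarrow> ('a \<Rightarrow> 'b) \<Rightarrow> bool" where
  "R_equivalent f f' \<longleftrightarrow> (\<exists>h. biholomorphism_germ h \<and> (\<forall>\<^sub>F x in nhds 0. f' (h x) = f x))"

text \<open>
  Tangent spaces are identified with the ambient vector space. A vector field along \<open>f\<close> is then
  any holomorphic germ between the source and target spaces (not necessarily vanishing at 0),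
  and a vector field is a vector field along the identity.
\<close>

definition theta_along ::
    "('a::complex_euclidean_space \<Rightarrow> 'b::complex_euclidean_space) \<Rightarrow> ('a \<Rightarrow> 'b) set" where
  "theta_along f = {\<xi>. holomorphic_germ \<xi>}"

abbreviation theta :: "('a::complex_euclidean_space \<Rightarrow> 'a) set" where
  "theta \<equiv> theta_along id"

definition stable :: "('a::complex_euclidean_space \<Rightarrow> 'b::complex_euclidean_space) \<Rightarrow> bool" where
  "stable f \<longleftrightarrow>
    theta_along f =
      {\<xi>. \<exists>\<zeta>\<in>theta. \<exists>\<eta>\<in>theta.
        \<forall>\<^sub>F x in nhds 0. \<xi> x = frechet_derivative f (at x) (\<zeta> x) + \<eta> (f x)}"

text \<open>
  For a germ of the form $F(x,\lambda) = (f_\lambda(x),\lambda)$ the member $f_\lambda$ of the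
  family is recovered as the first component of \<open>F\<close>.
\<close>

definition family :: "('a \<times> complex \<Rightarrow> 'b \<times> complex) \<Rightarrow> complex \<Rightarrow> 'a \<Rightarrow> 'b" where
  "family F l x = fst (F (x, l))"

definition is_OPSU ::
    "((complex ^ 'n) \<times> complex \<Rightarrow> (complex ^ 'p) \<times> complex) \<Rightarrow>
      (complex ^ 'n \<Rightarrow> complex ^ 'p) \<Rightarrow> bool"
  where
  "is_OPSU F f \<longleftrightarrow> map_germ F \<and> stable F \<and>
    (\<forall>\<^sub>F (x, l) in nhds 0. F (x, l) = (family F l x, l)) \<and>
    (\<forall>\<^sub>F x in nhds 0. family F 0 x = f x)"

definition augmentation ::
    "((complex ^ 'n) \<times> complex \<Rightarrow> (complex ^ 'p) \<times> complex) \<Rightarrow>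
      (complex ^ 'd \<Rightarrow> complex) \<Rightarrow> (complex ^ 'n) \<times> (complex ^ 'd) \<Rightarrow> (complex ^ 'p) \<times> (complex ^ 'd)" where
  "augmentation F g = (\<lambda>(x, z). (family F (g z) x, z))"

definition phi_equivalent ::
    "((complex ^ 'n) \<times> complex \<Rightarrow> (complex ^ 'p) \<times> complex) \<Rightarrow>
      ((complex ^ 'n) \<times> complex \<Rightarrow> (complex ^ 'p) \<times> complex) \<Rightarrow> bool" where
  "phi_equivalent F F' \<longleftrightarrow>
    (\<exists>h k l. biholomorphism_germ h \<and> biholomorphism_germ k \<and> biholomorphism_germ l \<and>
      (\<forall>\<^sub>F u in nhds 0. F' (h u) = k (F u)) \<and>
      (\<forall>\<^sub>F y in nhds 0. snd (k y) = l (snd y)))"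

definition quasi_homogeneous :: "(complex ^ 'd \<Rightarrow> complex) \<Rightarrow> bool" where
  "quasi_homogeneous q \<longleftrightarrow>
    (\<exists>(w::nat) (ws :: 'd \<Rightarrow> nat). w > 0 \<and> (\<forall>i. ws i > 0) \<and>
      (\<forall>(c::complex) z. q (\<chi> i. c ^ ws i * z $ i) = c ^ w * q z))"

end

theory Submission
  imports Defs "HOL-Complex_Analysis.Cauchy_Integral_Formula"
begin

text \<open>
  If \<open>(h, k, l)\<close> is a \<open>\<phi>\<close>-equivalence, then \<open>h\<close> also covers \<open>l\<close>. Suppose that \<open>l\<close> lifts along \<open>g\<close>,
  i.e. \<open>g \<circ> m = l \<circ> g\<close> for a biholomorphism germ \<open>m\<close> of the \<open>z\<close>-space. Then
  \<open>(x, z) \<mapsto> (fst (h (x, g z)), m z)\<close> and \<open>(y, z) \<mapsto> (fst (k (y, g z)), m z)\<close> are biholomorphism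
  germs giving the \<open>\<A>\<close>-equivalence of the augmentations. If \<open>g\<close> is quasi-homogeneous with weights
  \<open>w, w\<^sub>i\<close>, write \<open>l \<lambda> = v \<lambda> ^ w * \<lambda>\<close> with \<open>v\<close> holomorphic and nonvanishing; then
  \<open>m z = (v (g z) ^ w\<^sub>i * z\<^sub>i)\<^sub>i\<close> is a lift. Lifts are conjugated by \<open>\<R>\<close>-equivalences.
\<close>

section \<open>Complex differentiability at a point\<close>

text \<open>The pointwise condition inside \<open>holomorphic_germ\<close>, isolated so that
  holomorphy becomes an \<open>eventually\<close> statement and closure properties of germs follow
  from pointwise ones by \<open>eventually_elim\<close>.\<close>

definition C_differentiable_at ::
    "('a::complex_euclidean_space \<Rightarrow> 'b::complex_euclidean_space) \<Rightarrow> 'a \<Rightarrow> bool" where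
  "C_differentiable_at f x \<longleftrightarrow>
    (\<exists>f'. (f has_derivative f') (at x) \<and> (\<forall>c v. f' (c *\<^sub>C v) = c *\<^sub>C f' v))"

lemma holomorphic_germ_iff_eventually:
  "holomorphic_germ f \<longleftrightarrow> (\<forall>\<^sub>F x in nhds 0. C_differentiable_at f x)"
  unfolding holomorphic_germ_def eventually_nhds C_differentiable_at_def by blast

lemma C_differentiable_at_compose:
  assumes "C_differentiable_at g (f x)" "C_differentiable_at f x"
  shows "C_differentiable_at (\<lambda>x. g (f x)) x"
proof -
  obtain f' g' where "(f has_derivative f') (at x)" "\<forall>c v. f' (c *\<^sub>C v) = c *\<^sub>C f' v"
      "(g has_derivative g') (at (f x))" "\<forall>c v. g' (c *\<^sub>C v) = c *\<^sub>C g' v"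
    using assms unfolding C_differentiable_at_def by blast
  then show ?thesis
    unfolding C_differentiable_at_def
    by (intro exI[of _ "\<lambda>v. g' (f' v)"]) (auto intro: has_derivative_compose)
qed

lemma C_differentiable_at_Pair:
  assumes "C_differentiable_at f x" "C_differentiable_at g x"
  shows "C_differentiable_at (\<lambda>x. (f x, g x)) x"
proof -
  obtain f' g' where "(f has_derivative f') (at x)" "\<forall>c v. f' (c *\<^sub>C v) = c *\<^sub>C f' v"
      "(g has_derivative g') (at x)" "\<forall>c v. g' (c *\<^sub>C v) = c *\<^sub>C g' v"
    using assms unfolding C_differentiable_at_def by blast
  then show ?thesis
    unfolding C_differentiable_at_def
    by (intro exI[of _ "\<lambda>v. (f' v, g' v)"]) (auto intro: has_derivative_Pair simp: scaleC_prod_def)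
qed

lemma C_differentiable_at_linear:
  assumes "bounded_linear f" "\<And>c v. f (c *\<^sub>C v) = c *\<^sub>C f v"
  shows "C_differentiable_at f x"
  unfolding C_differentiable_at_def
  using assms bounded_linear_imp_has_derivative by blast

lemma C_differentiable_at_mult:
  fixes f g :: "'a::complex_euclidean_space \<Rightarrow> complex"
  assumes "C_differentiable_at f x" "C_differentiable_at g x"
  shows "C_differentiable_at (\<lambda>x. f x * g x) x"
proof -
  obtain f' g' where "(f has_derivative f') (at x)" "\<forall>c v. f' (c *\<^sub>C v) = c *\<^sub>C f' v"
      "(g has_derivative g') (at x)" "\<forall>c v. g' (c *\<^sub>C v) = c *\<^sub>C g' v"
    using assms unfolding C_differentiable_at_def by blast
  then show ?thesis
    unfolding C_differentiable_at_def
    by (intro exI[of _ "\<lambda>v. f x * g' v + f' v * g x"])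
       (auto intro: has_derivative_mult simp: scaleC_complex_def algebra_simps)
qed

lemma C_differentiable_at_vec_lambda:
  fixes f :: "'a::complex_euclidean_space \<Rightarrow> 'i::finite \<Rightarrow> 'b::complex_euclidean_space"
  assumes "\<And>i. C_differentiable_at (\<lambda>x. f x i) x"
  shows "C_differentiable_at (\<lambda>x. \<chi> i. f x i) x"
proof -
  obtain f' where f': "\<And>i. ((\<lambda>x. f x i) has_derivative f' i) (at x)"
      "\<And>i c v. f' i (c *\<^sub>C v) = c *\<^sub>C f' i v"
    using assms unfolding C_differentiable_at_def by metis
  \<comment> \<open>A vector is a finite sum of coordinate embeddings, so the sum and linear rules
    for derivatives apply.\<close>
  have axis: "(\<chi> i. h i) = (\<Sum>i\<in>UNIV. axis i (h i))" for h :: "'i \<Rightarrow> 'b"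
    by (simp add: vec_eq_iff axis_def)
  have "bounded_linear (axis i :: 'b \<Rightarrow> 'b ^ 'i)" for i
    by (intro linear_conv_bounded_linear[THEN iffD1] linearI) (simp_all add: vec_eq_iff axis_def)
  then have "((\<lambda>x. \<Sum>i\<in>UNIV. axis i (f x i)) has_derivative (\<lambda>v. \<Sum>i\<in>UNIV. axis i (f' i v))) (at x)"
    by (intro has_derivative_sum bounded_linear.has_derivative[where f = "axis _"] f'(1))
  then have "((\<lambda>x. \<chi> i. f x i) has_derivative (\<lambda>v. \<chi> i. f' i v)) (at x)"
    by (simp only: axis)
  with f'(2) show ?thesis
    unfolding C_differentiable_at_def
    by (intro exI[of _ "\<lambda>v. \<chi> i. f' i v"]) (auto simp: scaleC_vec_def)
qed

section \<open>Calculus of holomorphic germs\<close>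

lemma holomorphic_germ_tendsto:
  assumes "holomorphic_germ f"
  shows "filterlim f (nhds (f 0)) (nhds 0)"
proof -
  have "C_differentiable_at f 0"
    using assms eventually_nhds_x_imp_x unfolding holomorphic_germ_iff_eventually by blast
  then have "isCont f 0"
    unfolding C_differentiable_at_def using has_derivative_continuous by blast
  then show ?thesis
    by (simp add: isCont_def tendsto_at_iff_tendsto_nhds)
qed

text \<open>Continuity at 0 together with \<open>f 0 = 0\<close>. This is the substitution rule by
  which every identity of germs below is composed with another germ.\<close>

lemma eventually_map_germ:
  assumes "map_germ f" "\<forall>\<^sub>F y in nhds 0. P y"
  shows "\<forall>\<^sub>F x in nhds 0. P (f x)"
  using assms holomorphic_germ_tendsto[of f] unfolding map_germ_def filterlim_iff by metis

lemma holomorphic_germ_compose: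
  assumes "holomorphic_germ g" "map_germ f"
  shows "holomorphic_germ (\<lambda>x. g (f x))"
proof -
  have "\<forall>\<^sub>F x in nhds 0. C_differentiable_at g (f x)"
    using eventually_map_germ[OF assms(2)] assms(1) by (simp add: holomorphic_germ_iff_eventually)
  moreover have "\<forall>\<^sub>F x in nhds 0. C_differentiable_at f x"
    using assms(2) by (simp add: holomorphic_germ_iff_eventually map_germ_def)
  ultimately show ?thesis
    unfolding holomorphic_germ_iff_eventually
    by eventually_elim (rule C_differentiable_at_compose)
qed

lemma map_germ_compose: "map_germ g \<Longrightarrow> map_germ f \<Longrightarrow> map_germ (\<lambda>x. g (f x))"
  using holomorphic_germ_compose by (auto simp: map_germ_def)

lemma holomorphic_germ_Pair:
  assumes "holomorphic_germ f" "holomorphic_germ g"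
  shows "holomorphic_germ (\<lambda>x. (f x, g x))"
  using assms unfolding holomorphic_germ_iff_eventually
  by eventually_elim (rule C_differentiable_at_Pair)

lemma map_germ_Pair: "map_germ f \<Longrightarrow> map_germ g \<Longrightarrow> map_germ (\<lambda>x. (f x, g x))"
  by (simp add: map_germ_def holomorphic_germ_Pair zero_prod_def)

lemma map_germ_linear:
  assumes "bounded_linear f" "\<And>c v. f (c *\<^sub>C v) = c *\<^sub>C f v"
  shows "map_germ f"
  using assms C_differentiable_at_linear[of f] linear_0[of f]
  by (auto simp: map_germ_def holomorphic_germ_iff_eventually bounded_linear.linear)

lemma map_germ_fst: "map_germ fst" and map_germ_snd: "map_germ snd"
  by (auto intro!: map_germ_linear bounded_linear_fst bounded_linear_snd simp: scaleC_prod_def)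

lemma holomorphic_germ_mult:
  fixes f g :: "'a::complex_euclidean_space \<Rightarrow> complex"
  assumes "holomorphic_germ f" "holomorphic_germ g"
  shows "holomorphic_germ (\<lambda>x. f x * g x)"
  using assms unfolding holomorphic_germ_iff_eventually
  by eventually_elim (rule C_differentiable_at_mult)

lemma holomorphic_germ_power:
  fixes f :: "'a::complex_euclidean_space \<Rightarrow> complex"
  assumes "holomorphic_germ f"
  shows "holomorphic_germ (\<lambda>x. f x ^ n)"
proof (induction n)
  case 0
  show ?case
    by (auto simp: holomorphic_germ_def scaleC_complex_def
        intro!: exI[of _ UNIV] exI[of _ "\<lambda>_. 0"])
next
  case (Suc n)
  then show ?case
    using assms by (simp add: holomorphic_germ_mult)
qed

lemma holomorphic_germ_vec_lambda:
  assumes "\<And>i. holomorphic_germ (\<lambda>x. f x i)"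
  shows "holomorphic_germ (\<lambda>x. \<chi> i. f x i)"
proof -
  have "\<forall>\<^sub>F x in nhds 0. \<forall>i. C_differentiable_at (\<lambda>x. f x i) x"
    using assms unfolding holomorphic_germ_iff_eventually by (rule eventually_all_finite)
  then show ?thesis
    unfolding holomorphic_germ_iff_eventually
    by eventually_elim (auto intro: C_differentiable_at_vec_lambda)
qed

lemma map_germ_vec_nth: "map_germ (\<lambda>x::('b::complex_euclidean_space) ^ 'i. vec_nth x i)"
  by (auto intro!: map_germ_linear bounded_linear_vec_nth simp: scaleC_vec_def)

section \<open>Inverse germs\<close>

text \<open>The two-sided inverse as a relation with an explicit witness: swapping its arguments
  shows at once that the inverse germ is biholomorphic too.\<close>

definition germ_inverse :: "('a::{zero, topological_space} \<Rightarrow> 'a) \<Rightarrow> ('a \<Rightarrow> 'a) \<Rightarrow> bool" where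
  "germ_inverse h h' \<longleftrightarrow> (\<forall>\<^sub>F x in nhds 0. h' (h x) = x) \<and> (\<forall>\<^sub>F y in nhds 0. h (h' y) = y)"

lemma germ_inverse_sym: "germ_inverse h h' \<longleftrightarrow> germ_inverse h' h"
  unfolding germ_inverse_def by blast

lemma biholomorphism_germ_iff:
  "biholomorphism_germ h \<longleftrightarrow> map_germ h \<and> (\<exists>h'. map_germ h' \<and> germ_inverse h h')"
  unfolding biholomorphism_germ_def germ_inverse_def by blast

lemma biholomorphism_germI:
  "map_germ h \<Longrightarrow> map_germ h' \<Longrightarrow> germ_inverse h h' \<Longrightarrow> biholomorphism_germ h"
  unfolding biholomorphism_germ_iff by blast

lemma biholomorphism_germE:
  assumes "biholomorphism_germ h"
  obtains h' where "map_germ h" "map_germ h'" "germ_inverse h h'"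
  using assms unfolding biholomorphism_germ_iff by blast

lemma germ_inverse_compose:
  assumes "map_germ g'" "map_germ f" "germ_inverse f f'" "germ_inverse g g'"
  shows "germ_inverse (\<lambda>x. g (f x)) (\<lambda>x. f' (g' x))"
proof -
  have f: "\<forall>\<^sub>F x in nhds 0. f' (f x) = x" "\<forall>\<^sub>F y in nhds 0. f (f' y) = y"
    and g: "\<forall>\<^sub>F x in nhds 0. g' (g x) = x" "\<forall>\<^sub>F y in nhds 0. g (g' y) = y"
    using assms(3,4) by (simp_all add: germ_inverse_def)
  have "\<forall>\<^sub>F x in nhds 0. f' (g' (g (f x))) = x"
    using eventually_map_germ[OF assms(2) g(1)] f(1) by eventually_elim simp
  moreover have "\<forall>\<^sub>F x in nhds 0. g (f (f' (g' x))) = x"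
    using eventually_map_germ[OF assms(1) f(2)] g(2) by eventually_elim simp
  ultimately show ?thesis
    by (simp add: germ_inverse_def)
qed

lemma biholomorphism_germ_compose:
  assumes "biholomorphism_germ f" "biholomorphism_germ g"
  shows "biholomorphism_germ (\<lambda>x. g (f x))"
proof -
  obtain f' where f: "map_germ f" "map_germ f'" "germ_inverse f f'"
    using assms(1) by (rule biholomorphism_germE)
  obtain g' where g: "map_germ g" "map_germ g'" "germ_inverse g g'"
    using assms(2) by (rule biholomorphism_germE)
  show ?thesis
    by (rule biholomorphism_germI[OF map_germ_compose[OF g(1) f(1)] map_germ_compose[OF f(2) g(2)]
          germ_inverse_compose[OF g(2) f(1,3) g(3)]])
qed

text \<open>Substitute \<open>m' z\<close> for \<open>z\<close> in the hypothesis and apply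
  \<open>l'\<close> to both sides. It serves lifts along \<open>g\<close> and, with
  \<open>snd\<close> in place of \<open>g\<close>, maps fibred over \<open>l\<close>.\<close>

lemma intertwine_germ_inverse:
  assumes "map_germ m'" "germ_inverse m m'" "map_germ g" "germ_inverse l l'"
    and eq: "\<forall>\<^sub>F z in nhds 0. g (m z) = l (g z)"
  shows "\<forall>\<^sub>F z in nhds 0. g (m' z) = l' (g z)"
proof -
  have "\<forall>\<^sub>F z in nhds 0. g (m (m' z)) = l (g (m' z))"
    using assms(1) eq by (rule eventually_map_germ)
  moreover have "\<forall>\<^sub>F z in nhds 0. m (m' z) = z"
    using assms(2) unfolding germ_inverse_def by blast
  moreover have "\<forall>\<^sub>F z in nhds 0. l' (l (g (m' z))) = g (m' z)"
    using eventually_map_germ[OF map_germ_compose[OF assms(3,1)], of "\<lambda>y. l' (l y) = y"] assms(4)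
    unfolding germ_inverse_def by blast
  ultimately show ?thesis
    by eventually_elim simp
qed

section \<open>Pullback to the fibre product\<close>

text \<open>
  For \<open>h\<close> fibred over \<open>l\<close> and \<open>g \<circ> m = l \<circ> g\<close>, this is the map induced by \<open>h \<times> m\<close> on the fibre
  product \<open>{((x, \<lambda>), z). \<lambda> = g z}\<close>, in the coordinates \<open>(x, z)\<close>.
\<close>

definition pullback_map ::
    "('a \<times> complex \<Rightarrow> 'b \<times> complex) \<Rightarrow> ('d \<Rightarrow> complex) \<Rightarrow> ('d \<Rightarrow> 'e) \<Rightarrow> 'a \<times> 'd \<Rightarrow> 'b \<times> 'e" where
  "pullback_map h g m u = (fst (h (fst u, g (snd u))), m (snd u))"

lemma map_germ_base_change:
  "map_germ g \<Longrightarrow> map_germ (\<lambda>u. (fst u, g (snd u)))"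
  by (intro map_germ_Pair map_germ_fst map_germ_compose[OF _ map_germ_snd])

lemma map_germ_pullback_map:
  assumes "map_germ h" "map_germ g" "map_germ m"
  shows "map_germ (pullback_map h g m)"
  unfolding pullback_map_def[abs_def]
  by (intro map_germ_Pair map_germ_compose[OF map_germ_fst] map_germ_compose[OF assms(1)]
      map_germ_base_change map_germ_compose[OF assms(3)] map_germ_snd assms)

text \<open>Dropping the last coordinate of \<open>h (x, g z)\<close> loses nothing: it equals
  \<open>l (g z) = g (m z)\<close>, so it is recovered from \<open>m z\<close> and \<open>h'\<close>
  is applied to the full value of \<open>h\<close>. Being one-sided, the statement serves both
  compositions.\<close>

lemma pullback_map_left_inverse:
  fixes h :: "'a::complex_euclidean_space \<times> complex \<Rightarrow> 'b \<times> complex"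
    and m :: "'d::complex_euclidean_space \<Rightarrow> 'd"
  assumes "map_germ g"
    and "\<forall>\<^sub>F u in nhds 0. h' (h u) = u" "\<forall>\<^sub>F z in nhds 0. m' (m z) = z"
    and "\<forall>\<^sub>F u in nhds 0. snd (h u) = l (snd u)" "\<forall>\<^sub>F z in nhds 0. g (m z) = l (g z)"
  shows "\<forall>\<^sub>F u in nhds 0. pullback_map h' g m' (pullback_map h g m u) = u"
proof -
  note base = eventually_map_germ[OF map_germ_base_change[OF assms(1)]]
  have "\<forall>\<^sub>F u in nhds 0. h' (h (fst u, g (snd u))) = (fst u, g (snd u)) \<and> m' (m (snd u)) = snd u \<and>
      snd (h (fst u, g (snd u))) = l (g (snd u)) \<and> g (m (snd u)) = l (g (snd u))"
    using base[OF assms(2)] base[OF assms(4)]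
      eventually_map_germ[OF map_germ_snd assms(3)] eventually_map_germ[OF map_germ_snd assms(5)]
    by eventually_elim simp
  then show ?thesis
  proof eventually_elim
    case (elim u)
    then have "(fst (h (fst u, g (snd u))), g (m (snd u))) = h (fst u, g (snd u))"
      by (metis prod.collapse)
    with elim show ?case
      by (simp add: pullback_map_def)
  qed
qed

text \<open>The inverses \<open>h'\<close>, \<open>l'\<close>, \<open>m'\<close> satisfy the same
  two compatibility conditions, so their pullback inverts the given one.\<close>

lemma biholomorphism_germ_pullback_map:
  assumes "biholomorphism_germ h" "biholomorphism_germ l" "biholomorphism_germ m" "map_germ g"
    and fib: "\<forall>\<^sub>F u in nhds 0. snd (h u) = l (snd u)"
    and lift: "\<forall>\<^sub>F z in nhds 0. g (m z) = l (g z)"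
  shows "biholomorphism_germ (pullback_map h g m)"
proof -
  obtain h' where h: "map_germ h" "map_germ h'" "germ_inverse h h'"
    using assms(1) by (rule biholomorphism_germE)
  obtain l' where l: "map_germ l" "map_germ l'" "germ_inverse l l'"
    using assms(2) by (rule biholomorphism_germE)
  obtain m' where m: "map_germ m" "map_germ m'" "germ_inverse m m'"
    using assms(3) by (rule biholomorphism_germE)
  have "\<forall>\<^sub>F z in nhds 0. g (m' z) = l' (g z)"
    by (rule intertwine_germ_inverse[OF m(2,3) assms(4) l(3) lift])
  moreover have "\<forall>\<^sub>F u in nhds 0. snd (h' u) = l' (snd u)"
    by (rule intertwine_germ_inverse[OF h(2,3) map_germ_snd l(3) fib])
  ultimately have "germ_inverse (pullback_map h g m) (pullback_map h' g m')"
    using h m fib lift unfolding germ_inverse_def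
    by (intro conjI pullback_map_left_inverse[OF assms(4)]) auto
  then show ?thesis
    using h m assms(4) by (blast intro: biholomorphism_germI map_germ_pullback_map)
qed

section \<open>Lifting a biholomorphism of the line\<close>

text \<open>Since \<open>l 0 = 0\<close>, \<open>l\<close> is the product of a holomorphic
  \<open>u\<close> and the coordinate; \<open>u 0\<close> is the derivative of \<open>l\<close> at
  0, nonzero by invertibility, so \<open>u\<close> has a holomorphic root of order \<open>w\<close>
  near 0.\<close>

lemma biholomorphism_germ_root_factor:
  assumes "biholomorphism_germ l" "w > 0"
  obtains v :: "complex \<Rightarrow> complex" where "holomorphic_germ v" "v 0 \<noteq> 0"
    "\<forall>\<^sub>F x in nhds 0. l x = v x ^ w * x"
proof -
  obtain k where l: "map_germ l" "map_germ k" "germ_inverse l k"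
    using assms(1) by (rule biholomorphism_germE)
  then have l0: "l 0 = 0" and "l analytic_on {0}" and kan: "k analytic_on {0}"
    by (auto simp: map_germ_def holomorphic_germ_complex_iff)
  then obtain S where S: "open S" "0 \<in> S" "l holomorphic_on S"
    unfolding analytic_at by blast
  \<comment> \<open>The difference quotient of \<open>l\<close> at 0 with its removable singularity
    filled.\<close>
  define u where "u = (\<lambda>z. if z = 0 then deriv l 0 else (l z - l 0) / (z - 0))"
  have u: "u holomorphic_on S"
    unfolding u_def by (rule pole_lemma_open[OF S(3,1)])
  have lu: "l z = u z * z" for z
    by (simp add: u_def l0)
  \<comment> \<open>Otherwise the chain rule gives derivative 0 at 0 to \<open>k\<close> after
    \<open>l\<close>, which is the identity near 0.\<close>
  have "deriv l 0 \<noteq> 0"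
  proof
    assume "deriv l 0 = 0"
    then have "(l has_field_derivative 0) (at 0)"
      using \<open>l analytic_on {0}\<close>
      by (metis analytic_on_imp_differentiable_at DERIV_deriv_iff_field_differentiable insertI1)
    moreover have "(k has_field_derivative deriv k (l 0)) (at (l 0))"
      using kan l0
      by (metis analytic_on_imp_differentiable_at DERIV_deriv_iff_field_differentiable insertI1)
    ultimately have "((\<lambda>x. k (l x)) has_field_derivative deriv k (l 0) * 0) (at 0)"
      by (rule DERIV_chain2[rotated])
    moreover have "\<forall>\<^sub>F x in nhds 0. k (l x) = x"
      using l(3) unfolding germ_inverse_def by blast
    ultimately have "((\<lambda>x. x) has_field_derivative (0::complex)) (at 0)"
      using DERIV_cong_ev[OF refl _ refl, of "\<lambda>x. k (l x)" "\<lambda>x. x" 0] by simp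
    then show False
      using DERIV_ident DERIV_unique by fastforce
  qed
  then have u0: "u 0 \<noteq> 0"
    by (simp add: u_def)
  text \<open>Dividing by \<open>u 0\<close> moves the argument of \<open>Ln\<close> away from its branch cut.\<close>
  define v where "v = (\<lambda>z. exp ((Ln (u 0) + Ln (u z / u 0)) / of_nat w))"
  have uan: "u analytic_on {0}"
    using u S analytic_at by blast
  then have "v analytic_on {0}"
    unfolding v_def using u0 assms(2) by (auto intro!: analytic_intros)
  then have "holomorphic_germ v"
    by (simp add: holomorphic_germ_complex_iff)
  moreover have "v 0 \<noteq> 0"
    by (simp add: v_def)
  moreover have "\<forall>\<^sub>F x in nhds 0. l x = v x ^ w * x"
  proof -
    have "isCont u 0"
      using uan analytic_at_imp_isCont by blast
    then have "filterlim u (nhds (u 0)) (nhds 0)"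
      by (simp add: isCont_def tendsto_at_iff_tendsto_nhds)
    with u0 have "\<forall>\<^sub>F x in nhds 0. u x \<noteq> 0"
      using tendsto_imp_eventually_ne by blast
    then show ?thesis
    proof eventually_elim
      case (elim x)
      have "v x ^ w = exp (of_nat w * ((Ln (u 0) + Ln (u x / u 0)) / of_nat w))"
        unfolding v_def by (rule exp_of_nat_mult[symmetric])
      also have "\<dots> = u x"
        using assms(2) u0 elim by (simp add: exp_add)
      finally show ?case
        by (simp add: lu)
    qed
  qed
  ultimately show thesis
    by (rule that)
qed

lemma map_germ_weighted_scaling:
  fixes q :: "complex ^ 'd \<Rightarrow> complex"
  assumes "map_germ q" "holomorphic_germ v"
  shows "map_germ (\<lambda>z. \<chi> i. v (q z) ^ ws i * vec_nth z i)"
  using assms map_germ_vec_nth unfolding map_germ_def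
  by (auto simp: vec_eq_iff map_germ_def
      intro!: holomorphic_germ_vec_lambda holomorphic_germ_mult holomorphic_germ_power
        holomorphic_germ_compose[of v])

text \<open>Homogeneity with the scale \<open>v (q z)\<close>, constant in the identity at each
  fixed \<open>z\<close>, gives \<open>q (m z) = v (q z) ^ w * q z = l (q z)\<close>. The inverse of
  \<open>m\<close> is again a weighted scaling by a function of \<open>q\<close>.\<close>

lemma quasi_homogeneous_lift:
  fixes q :: "complex ^ 'd \<Rightarrow> complex"
  assumes q: "map_germ q" "quasi_homogeneous q" and "biholomorphism_germ l"
  obtains m where "biholomorphism_germ m" "\<forall>\<^sub>F z in nhds 0. q (m z) = l (q z)"
proof -
  obtain w ws where w: "w > 0"
    and hom: "\<And>c z. q (\<chi> i. c ^ ws i * vec_nth z i) = c ^ w * q z"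
    using q(2) unfolding quasi_homogeneous_def by blast
  obtain v where v: "holomorphic_germ v" "v 0 \<noteq> 0" "\<forall>\<^sub>F x in nhds 0. l x = v x ^ w * x"
    using assms(3) w by (rule biholomorphism_germ_root_factor)
  obtain l' where l: "map_germ l" "map_germ l'" "germ_inverse l l'"
    using assms(3) by (rule biholomorphism_germE)
  define m where "m = (\<lambda>z. \<chi> i. v (q z) ^ ws i * vec_nth z i)"
  \<comment> \<open>To undo the scaling at \<open>z\<close>, only \<open>q (m z) = l (q z)\<close>
    is at hand; \<open>l'\<close> recovers \<open>q z\<close> from it, hence the scale to be
    inverted.\<close>
  define v' where "v' = (\<lambda>y. inverse (v (l' y)))"
  define m' where "m' = (\<lambda>z. \<chi> i. v' (q z) ^ ws i * vec_nth z i)"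
  have vne: "\<forall>\<^sub>F x in nhds 0. v x \<noteq> 0"
    using tendsto_imp_eventually_ne[OF holomorphic_germ_tendsto[OF v(1)] v(2)] .
  have "(\<lambda>y. v (l' y)) analytic_on {0}"
    using holomorphic_germ_compose[OF v(1) l(2)] by (simp add: holomorphic_germ_complex_iff)
  then have "holomorphic_germ v'"
    using v(2) l(2) unfolding v'_def holomorphic_germ_complex_iff map_germ_def
    by (auto intro!: analytic_intros)
  then have germs: "map_germ m" "map_germ m'"
    unfolding m_def m'_def using q(1) v(1) by (auto intro: map_germ_weighted_scaling)
  have lift: "\<forall>\<^sub>F z in nhds 0. q (m z) = l (q z)"
    using eventually_map_germ[OF q(1) v(3)] by eventually_elim (simp add: m_def hom)
  have "\<forall>\<^sub>F z in nhds 0. m' (m z) = z"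
  proof -
    have "\<forall>\<^sub>F z in nhds 0. l' (l (q z)) = q z"
      using eventually_map_germ[OF q(1), of "\<lambda>y. l' (l y) = y"] l(3) unfolding germ_inverse_def by blast
    with lift eventually_map_germ[OF q(1) vne] show ?thesis
    proof eventually_elim
      case (elim z)
      then have "v' (q (m z)) * v (q z) = 1"
        by (simp add: v'_def)
      then show ?case
        by (simp add: m'_def vec_eq_iff) (simp add: m_def flip: mult.assoc power_mult_distrib)
    qed
  qed
  moreover have "\<forall>\<^sub>F z in nhds 0. m (m' z) = z"
  proof -
    have "\<forall>\<^sub>F z in nhds 0. l (l' (q z)) = q z"
      using eventually_map_germ[OF q(1), of "\<lambda>y. l (l' y) = y"] l(3) unfolding germ_inverse_def by blast
    with eventually_map_germ[OF map_germ_compose[OF l(2) q(1)] vne]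
      eventually_map_germ[OF map_germ_compose[OF l(2) q(1)] v(3)]
    show ?thesis
    proof eventually_elim
      case (elim z)
      \<comment> \<open>Homogeneity with scale \<open>v' (q z)\<close>, where \<open>q z\<close> is
        rewritten as \<open>l (l' (q z))\<close> and then factored through \<open>v\<close>.\<close>
      have "q (m' z) = v' (q z) ^ w * (v (l' (q z)) ^ w * l' (q z))"
        using elim(2,3) hom[of "v' (q z)" z] by (simp add: m'_def)
      also have "\<dots> = l' (q z)"
        using elim(1) by (simp add: v'_def flip: mult.assoc power_mult_distrib)
      \<comment> \<open>Thus \<open>m\<close> rescales at \<open>m' z\<close> by
        \<open>v (l' (q z))\<close>, exactly the reciprocal of the scale of \<open>m'\<close> at
        \<open>z\<close>.\<close>
      finally have "v (q (m' z)) * v' (q z) = 1"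
        using elim by (simp add: v'_def)
      then show ?case
        by (simp add: m_def vec_eq_iff) (simp add: m'_def flip: mult.assoc power_mult_distrib)
    qed
  qed
  ultimately have "biholomorphism_germ m"
    using germs by (intro biholomorphism_germI) (auto simp: germ_inverse_def)
  with lift show thesis
    by (rule that[rotated])
qed

text \<open>If \<open>r\<close> carries \<open>g\<close> to \<open>q\<close> and \<open>s\<close>
  inverts \<open>r\<close>, then the conjugate \<open>s (m (r z))\<close> works: its value under
  \<open>g\<close> is \<open>q (m (r z)) = l (q (r z)) = l (g z)\<close>.\<close>

lemma R_equivalent_lift:
  assumes "R_equivalent g q" "biholomorphism_germ m" "\<forall>\<^sub>F z in nhds 0. q (m z) = l (q z)"
  obtains m' where "biholomorphism_germ m'" "\<forall>\<^sub>F z in nhds 0. g (m' z) = l (g z)"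
proof -
  obtain r where r: "biholomorphism_germ r" "\<forall>\<^sub>F z in nhds 0. q (r z) = g z"
    using assms(1) unfolding R_equivalent_def by blast
  obtain s where s: "map_germ r" "map_germ s" "germ_inverse r s"
    using r(1) by (rule biholomorphism_germE)
  have bi: "biholomorphism_germ (\<lambda>z. m (r z))"
    using r(1) assms(2) by (rule biholomorphism_germ_compose)
  then have mr: "map_germ (\<lambda>z. m (r z))"
    by (simp add: biholomorphism_germ_def)
  have "biholomorphism_germ s"
    using s(2,1) s(3)[unfolded germ_inverse_sym[of r]] by (rule biholomorphism_germI)
  with bi have "biholomorphism_germ (\<lambda>z. s (m (r z)))"
    by (rule biholomorphism_germ_compose)
  moreover have "\<forall>\<^sub>F y in nhds 0. r (s y) = y"
    using s(3) unfolding germ_inverse_def by blast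
  then have "\<forall>\<^sub>F z in nhds 0. r (s (m (r z))) = m (r z)"
    by (rule eventually_map_germ[OF mr])
  with eventually_map_germ[OF map_germ_compose[OF s(2) mr] r(2)] r(2)
    eventually_map_germ[OF s(1) assms(3)]
  have "\<forall>\<^sub>F z in nhds 0. g (s (m (r z))) = l (g z)"
    by eventually_elim simp
  ultimately show thesis
    by (rule that)
qed

section \<open>Equivalence of the augmentations\<close>

lemma is_OPSU_snd:
  assumes "is_OPSU F f"
  shows "\<forall>\<^sub>F u in nhds 0. snd (F u) = snd u"
proof -
  have "\<forall>\<^sub>F u in nhds 0. F u = (family F (snd u) (fst u), snd u)"
    using assms by (simp add: is_OPSU_def case_prod_unfold)
  then show ?thesis
    by eventually_elim (metis snd_conv)
qed

theorem theorem5p4: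
  fixes f f' :: "complex ^ 'n \<Rightarrow> complex ^ 'p"
    and F F' :: "(complex ^ 'n) \<times> complex \<Rightarrow> (complex ^ 'p) \<times> complex"
    and g :: "complex ^ 'd \<Rightarrow> complex"
  assumes "map_germ f" and "map_germ f'"
    and "is_OPSU F f" and "is_OPSU F' f'"
    and "phi_equivalent F F'"
    and "map_germ g"
    and "\<exists>q. map_germ q \<and> quasi_homogeneous q \<and> R_equivalent g q"
  shows "A_equivalent (augmentation F g) (augmentation F' g)"
proof -
  obtain h k l where bih: "biholomorphism_germ h" "biholomorphism_germ k" "biholomorphism_germ l"
    and comm: "\<forall>\<^sub>F u in nhds 0. F' (h u) = k (F u)"
    and kfib: "\<forall>\<^sub>F y in nhds 0. snd (k y) = l (snd y)"
    using assms(5) unfolding phi_equivalent_def by blast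
  have mF: "map_germ F"
    using assms(3) by (simp add: is_OPSU_def)
  note F = is_OPSU_snd[OF assms(3)] and F' = is_OPSU_snd[OF assms(4)]
  have mh: "map_germ h"
    using bih(1) by (simp add: biholomorphism_germ_def)
  \<comment> \<open>Compare last coordinates in \<open>F' (h u) = k (F u)\<close>: both
    \<open>F\<close> and \<open>F'\<close> preserve the last coordinate, and \<open>k\<close> acts
    on it by \<open>l\<close>.\<close>
  have hfib: "\<forall>\<^sub>F u in nhds 0. snd (h u) = l (snd u)"
    using eventually_map_germ[OF mh F'] comm eventually_map_germ[OF mF kfib] F
    by eventually_elim simp
  obtain q where q: "map_germ q" "quasi_homogeneous q" and gq: "R_equivalent g q"
    using assms(7) by blast
  obtain m\<^sub>q where "biholomorphism_germ m\<^sub>q" "\<forall>\<^sub>F z in nhds 0. q (m\<^sub>q z) = l (q z)"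
    using q bih(3) by (rule quasi_homogeneous_lift)
  with gq obtain m where m: "biholomorphism_germ m" "\<forall>\<^sub>F z in nhds 0. g (m z) = l (g z)"
    by (rule R_equivalent_lift)
  note base = eventually_map_germ[OF map_germ_base_change[OF assms(6)]]
  have "\<forall>\<^sub>F u in nhds 0. augmentation F' g (pullback_map h g m u) =
      pullback_map k g m (augmentation F g u)"
    using base[OF hfib] base[OF comm] base[OF F] eventually_map_germ[OF map_germ_snd m(2)]
  proof eventually_elim
    case (elim u)
    \<comment> \<open>The parameters \<open>g (m z)\<close> and \<open>g z\<close> that the
      augmentations insert are the last coordinates of \<open>h (x, g z)\<close> and
      \<open>F (x, g z)\<close>, so the claim reduces to \<open>comm\<close> at
      \<open>(x, g z)\<close>.\<close>
    have "(fst (h (fst u, g (snd u))), g (m (snd u))) = h (fst u, g (snd u))"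
      using elim by (simp add: prod_eq_iff)
    moreover have "(fst (F (fst u, g (snd u))), g (snd u)) = F (fst u, g (snd u))"
      using elim by (simp add: prod_eq_iff)
    ultimately show ?case
      using elim by (simp add: augmentation_def pullback_map_def family_def case_prod_unfold)
  qed
  then show ?thesis
    unfolding A_equivalent_def
    using biholomorphism_germ_pullback_map[OF bih(1,3) m(1) assms(6) hfib m(2)]
      biholomorphism_germ_pullback_map[OF bih(2,3) m(1) assms(6) kfib m(2)] by blast
qed

end
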